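(* Let $\phi^{n+1}$ be obtained from $\phi^n$ by one time step of the two-dimensional dimensional-splitting upwind-SAV scheme described in the context. If $|\phi_{i,j}^{n}|<1$ for all $1\le i\le N_x$, $1\le j\le N_y$, then $|\phi_{i,j}^{n+1}|<1$ for all $1\le i\le N_x$, $1\le j\le N_y$.
   Context: Parameters: integers $N_x,N_y\ge2$, cell sizes $\Delta x,\Delta y>0$, time step $\Delta t>0$, interface parameter $\varepsilon>0$, a positive integer $k$. The potential $F:I\to\mathbb{R}$ is the free energy density, differentiable on its domain of definition $I\subseteq\mathbb{R}$, an interval; typical choices are the logarithmic Flory--Huggins potential $F(\phi)=\frac{\theta}{2}[(1+\phi)\ln(1+\phi)+(1-\phi)\ln(1-\phi)]+\frac{\theta_c}{2}(1-\phi^2)$ with $0<\theta<\theta_c$ (differentiable on $I=(-1,1)$), or the polynomial potential $F(\phi)=\frac14(1-\phi^2)^2$ (with $I=\mathbb{R}$). All arrays of cell averages below take values in $I$. Notation: $\chi^+=\max\{\chi,0\}$, $\chi^-=\min\{\chi,0\}$, and $M(\chi_1,\chi_2)=\big[(1+\chi_1)^+(1-\chi_2)^+\big]^k$. For an array $\psi=(\psi_{i,j})_{1\le i\le N_x,1\le j\le N_y}$ the discrete Laplacian with Neumann boundary conditions is $$(\Delta\psi)_{i,j}=\frac{\psi_{i+1,j}-2\psi_{i,j}+\psi_{i-1,j}}{\Delta x^2}+\frac{\psi_{i,j+1}-2\psi_{i,j}+\psi_{i,j-1}}{\Delta y^2},$$ with the convention $\psi_{0,j}:=\psi_{1,j}$,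 $\psi_{N_x+1,j}:=\psi_{N_x,j}$, $\psi_{i,0}:=\psi_{i,1}$, $\psi_{i,N_y+1}:=\psi_{i,N_y}$. Scheme (one time step from $\phi^n$ to $\phi^{n+1}$): Step 1 ($x$-direction). Set $\widetilde\phi^{n,0}=\phi^n$. For $q=1,\dots,N_y$ successively, the array $\widetilde\phi^{n,q}$ and the scalar $\widetilde\xi^{n,q}\in\mathbb{R}$ satisfy $$\widetilde\phi_{i,j}^{n,q}-\widetilde\phi_{i,j}^{n,q-1}=\begin{cases}-\frac{\Delta t}{\Delta x}\left(\widetilde J_{i+\frac12,j}^{n,q}-\widetilde J_{i-\frac12,j}^{n,q}\right),& j=q,\\ 0,& j\ne q,\end{cases}$$ $$\widetilde J_{i+\frac12,j}^{n,q}=\left(\widetilde V_{i+\frac12,j}^{n,q}\right)^+M(\widetilde\phi_{i,j}^{n,q},\widetilde\phi_{i+1,j}^{n,q})+\left(\widetilde V_{i+\frac12,j}^{n,q}\right)^-M(\widetilde\phi_{i+1,j}^{n,q},\widetilde\phi_{i,j}^{n,q}),\quad 1\le i\le N_x-1,$$ $$\widetilde V_{i+\frac12,j}^{n,q}=-\frac1{\Delta x}\left(\widetilde\mu_{i+1,j}^{n,q}-\widetilde\mu_{i,j}^{n,q}\right),\qquad \widetilde\mu_{i,j}^{n,q}=-\varepsilon^2(\Delta\widetilde\phi^{n,q})_{i,j}+\widetilde\xi^{n,q}F'(\widetilde\phi_{i,j}^{n,q}),$$ $$\sum_{i=1}^{N_x}\sum_{j=1}^{N_y}\left(F(\widetilde\phi_{i,j}^{n,q})-F(\widetilde\phi_{i,j}^{n,q-1})\right)=\widetilde\xi^{n,q}\sum_{i=1}^{N_x}\sum_{j=1}^{N_y}F'(\widetilde\phi_{i,j}^{n,q})(\widetilde\phi_{i,j}^{n,q}-\widetilde\phi_{i,j}^{n,q-1}),$$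 with no-flux conditions $\widetilde J_{\frac12,j}^{n,q}=\widetilde J_{N_x+\frac12,j}^{n,q}=0$ for all $j$. Step 2 ($y$-direction). Set $\widehat\phi^{n,0}=\widetilde\phi^{n,N_y}$. For $p=1,\dots,N_x$ successively, the array $\widehat\phi^{n,p}$ and the scalar $\widehat\xi^{n,p}\in\mathbb{R}$ satisfy $$\widehat\phi_{i,j}^{n,p}-\widehat\phi_{i,j}^{n,p-1}=\begin{cases}-\frac{\Delta t}{\Delta y}\left(\widehat J_{i,j+\frac12}^{n,p}-\widehat J_{i,j-\frac12}^{n,p}\right),& i=p,\\ 0,& i\ne p,\end{cases}$$ $$\widehat J_{i,j+\frac12}^{n,p}=\left(\widehat V_{i,j+\frac12}^{n,p}\right)^+M(\widehat\phi_{i,j}^{n,p},\widehat\phi_{i,j+1}^{n,p})+\left(\widehat V_{i,j+\frac12}^{n,p}\right)^-M(\widehat\phi_{i,j+1}^{n,p},\widehat\phi_{i,j}^{n,p}),\quad 1\le j\le N_y-1,$$ $$\widehat V_{i,j+\frac12}^{n,p}=-\frac1{\Delta y}\left(\widehat\mu_{i,j+1}^{n,p}-\widehat\mu_{i,j}^{n,p}\right),\qquad \widehat\mu_{i,j}^{n,p}=-\varepsilon^2(\Delta\widehat\phi^{n,p})_{i,j}+\widehat\xi^{n,p}F'(\widehat\phi_{i,j}^{n,p}),$$ $$\sum_{i=1}^{N_x}\sum_{j=1}^{N_y}\left(F(\widehat\phi_{i,j}^{n,p})-F(\widehat\phi_{i,j}^{n,p-1})\right)=\widehat\xi^{n,p}\sum_{i=1}^{N_x}\sum_{j=1}^{N_y}F'(\widehat\phi_{i,j}^{n,p})(\widehat\phi_{i,j}^{n,p}-\widehat\phi_{i,j}^{n,p-1}),$$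 with no-flux conditions $\widehat J_{i,\frac12}^{n,p}=\widehat J_{i,N_y+\frac12}^{n,p}=0$ for all $i$. Finally $\phi^{n+1}=\widehat\phi^{n,N_x}$ and $\xi^{n+1}=\frac{1}{N_x+N_y}\left(\sum_{q=1}^{N_y}\widetilde\xi^{n,q}+\sum_{p=1}^{N_x}\widehat\xi^{n,p}\right)$. *)

theory Defs
  imports "HOL-Analysis.Analysis"
begin

text \<open>Arrays of cell averages are functions of type \<^typ>\<open>nat \<Rightarrow> nat \<Rightarrow> real\<close>; only their values on the
  grid \<^term>\<open>{1..Nx} \<times> {1..Ny}\<close> are used or constrained.\<close>

definition mobility :: "nat \<Rightarrow> real \<Rightarrow> real \<Rightarrow> real" where
  "mobility k \<chi>1 \<chi>2 = (max (1 + \<chi>1) 0 * max (1 - \<chi>2) 0) ^ k"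

definition upwind_flux :: "nat \<Rightarrow> real \<Rightarrow> real \<Rightarrow> real \<Rightarrow> real" where
  "upwind_flux k V a b = max V 0 * mobility k a b + min V 0 * mobility k b a"

text \<open>Index reflection implementing the Neumann convention: the ghost cells 0 and \<open>N + 1\<close> carry
  the values of the cells 1 and \<open>N\<close>.\<close>

definition reflect :: "nat \<Rightarrow> nat \<Rightarrow> nat" where
  "reflect N i = (if i = 0 then 1 else if i = N + 1 then N else i)"

definition discrete_laplacian ::
    "nat \<Rightarrow> nat \<Rightarrow> real \<Rightarrow> real \<Rightarrow> (nat \<Rightarrow> nat \<Rightarrow> real) \<Rightarrow> nat \<Rightarrow> nat \<Rightarrow> real" where
  "discrete_laplacian Nx Ny dx dy \<psi> i j =
     (\<psi> (reflect Nx (i + 1)) j - 2 * \<psi> i j + \<psi> (reflect Nx (i - 1)) j) / dx\<^sup>2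
   + (\<psi> i (reflect Ny (j + 1)) - 2 * \<psi> i j + \<psi> i (reflect Ny (j - 1))) / dy\<^sup>2"

context
  fixes Nx Ny :: nat and dx dy dt \<epsilon> :: real and k :: nat
    and I :: "real set" and F F' :: "real \<Rightarrow> real"
begin

definition chem_pot :: "(nat \<Rightarrow> nat \<Rightarrow> real) \<Rightarrow> real \<Rightarrow> nat \<Rightarrow> nat \<Rightarrow> real" where
  "chem_pot \<psi> \<xi> i j = - \<epsilon>\<^sup>2 * discrete_laplacian Nx Ny dx dy \<psi> i j + \<xi> * F' (\<psi> i j)"

text \<open>Index \<open>i\<close> of an \<open>x\<close>-edge quantity stands for \<open>i + 1/2\<close>, likewise \<open>j\<close> in the \<open>y\<close>-direction.
  The \<open>else\<close> branches are the no-flux boundary conditions.\<close>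

definition velocity_x :: "(nat \<Rightarrow> nat \<Rightarrow> real) \<Rightarrow> real \<Rightarrow> nat \<Rightarrow> nat \<Rightarrow> real" where
  "velocity_x \<psi> \<xi> i j = - (1 / dx) * (chem_pot \<psi> \<xi> (i + 1) j - chem_pot \<psi> \<xi> i j)"

definition flux_x :: "(nat \<Rightarrow> nat \<Rightarrow> real) \<Rightarrow> real \<Rightarrow> nat \<Rightarrow> nat \<Rightarrow> real" where
  "flux_x \<psi> \<xi> i j =
     (if 1 \<le> i \<and> i \<le> Nx - 1
      then upwind_flux k (velocity_x \<psi> \<xi> i j) (\<psi> i j) (\<psi> (i + 1) j) else 0)"

definition velocity_y :: "(nat \<Rightarrow> nat \<Rightarrow> real) \<Rightarrow> real \<Rightarrow> nat \<Rightarrow> nat \<Rightarrow> real" where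
  "velocity_y \<psi> \<xi> i j = - (1 / dy) * (chem_pot \<psi> \<xi> i (j + 1) - chem_pot \<psi> \<xi> i j)"

definition flux_y :: "(nat \<Rightarrow> nat \<Rightarrow> real) \<Rightarrow> real \<Rightarrow> nat \<Rightarrow> nat \<Rightarrow> real" where
  "flux_y \<psi> \<xi> i j =
     (if 1 \<le> j \<and> j \<le> Ny - 1
      then upwind_flux k (velocity_y \<psi> \<xi> i j) (\<psi> i j) (\<psi> i (j + 1)) else 0)"

definition sav_relation :: "(nat \<Rightarrow> nat \<Rightarrow> real) \<Rightarrow> (nat \<Rightarrow> nat \<Rightarrow> real) \<Rightarrow> real \<Rightarrow> bool" where
  "sav_relation \<psi> \<psi>' \<xi> \<longleftrightarrow>
     (\<Sum>i=1..Nx. \<Sum>j=1..Ny. F (\<psi>' i j) - F (\<psi> i j))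
     = \<xi> * (\<Sum>i=1..Nx. \<Sum>j=1..Ny. F' (\<psi>' i j) * (\<psi>' i j - \<psi> i j))"

definition substep_x ::
    "nat \<Rightarrow> (nat \<Rightarrow> nat \<Rightarrow> real) \<Rightarrow> (nat \<Rightarrow> nat \<Rightarrow> real) \<Rightarrow> real \<Rightarrow> bool" where
  "substep_x q \<psi> \<psi>' \<xi> \<longleftrightarrow>
     (\<forall>i\<in>{1..Nx}. \<forall>j\<in>{1..Ny}.
        \<psi>' i j - \<psi> i j =
          (if j = q then - (dt / dx) * (flux_x \<psi>' \<xi> i j - flux_x \<psi>' \<xi> (i - 1) j) else 0))
     \<and> sav_relation \<psi> \<psi>' \<xi>"

definition substep_y ::
    "nat \<Rightarrow> (nat \<Rightarrow> nat \<Rightarrow> real) \<Rightarrow> (nat \<Rightarrow> nat \<Rightarrow> real) \<Rightarrow> real \<Rightarrow> bool" where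
  "substep_y p \<psi> \<psi>' \<xi> \<longleftrightarrow>
     (\<forall>i\<in>{1..Nx}. \<forall>j\<in>{1..Ny}.
        \<psi>' i j - \<psi> i j =
          (if i = p then - (dt / dy) * (flux_y \<psi>' \<xi> i j - flux_y \<psi>' \<xi> i (j - 1)) else 0))
     \<and> sav_relation \<psi> \<psi>' \<xi>"

definition grid_eq :: "(nat \<Rightarrow> nat \<Rightarrow> real) \<Rightarrow> (nat \<Rightarrow> nat \<Rightarrow> real) \<Rightarrow> bool" where
  "grid_eq \<psi> \<psi>' \<longleftrightarrow> (\<forall>i\<in>{1..Nx}. \<forall>j\<in>{1..Ny}. \<psi> i j = \<psi>' i j)"

definition grid_in_domain :: "(nat \<Rightarrow> nat \<Rightarrow> real) \<Rightarrow> bool" where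
  "grid_in_domain \<psi> \<longleftrightarrow> (\<forall>i\<in>{1..Nx}. \<forall>j\<in>{1..Ny}. \<psi> i j \<in> I)"

text \<open>One time step from \<open>\<phi>\<close> to \<open>(\<phi>', \<xi>')\<close>. The scheme is implicit, so this is a relation: no
  existence or uniqueness of the intermediate arrays is presupposed.\<close>

definition time_step ::
    "(nat \<Rightarrow> nat \<Rightarrow> real) \<Rightarrow> (nat \<Rightarrow> nat \<Rightarrow> real) \<Rightarrow> real \<Rightarrow> bool" where
  "time_step \<phi> \<phi>' \<xi>' \<longleftrightarrow>
     (\<exists>(\<phi>x :: nat \<Rightarrow> nat \<Rightarrow> nat \<Rightarrow> real) (\<xi>x :: nat \<Rightarrow> real)
       (\<phi>y :: nat \<Rightarrow> nat \<Rightarrow> nat \<Rightarrow> real) (\<xi>y :: nat \<Rightarrow> real).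
        (\<forall>q\<in>{0..Ny}. grid_in_domain (\<phi>x q))
      \<and> (\<forall>p\<in>{0..Nx}. grid_in_domain (\<phi>y p))
      \<and> grid_eq (\<phi>x 0) \<phi>
      \<and> (\<forall>q\<in>{1..Ny}. substep_x q (\<phi>x (q - 1)) (\<phi>x q) (\<xi>x q))
      \<and> grid_eq (\<phi>y 0) (\<phi>x Ny)
      \<and> (\<forall>p\<in>{1..Nx}. substep_y p (\<phi>y (p - 1)) (\<phi>y p) (\<xi>y p))
      \<and> grid_eq \<phi>' (\<phi>y Nx)
      \<and> \<xi>' = 1 / (real Nx + real Ny) * ((\<Sum>q=1..Ny. \<xi>x q) + (\<Sum>p=1..Nx. \<xi>y p)))"

end

end

theory Submission imports Defs begin

text \<open>If an updated cell value is at most \<open>-1\<close>, the mobility vanishes for every flux leaving that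
  cell, so the net flux is inward and the value cannot have dropped below its old value, which
  exceeds \<open>-1\<close>. A value of at least \<open>1\<close> likewise blocks every flux entering the cell. The argument
  is pointwise and insensitive to the velocities, hence to \<open>F\<close> and the auxiliary scalars.\<close>

lemma mobility_nonneg: "0 \<le> mobility k a b"
  by (simp add: mobility_def)

text \<open>One of the two truncated factors is zero. Positivity of \<open>k\<close> matters here
  because \<open>0 ^ 0 = 1\<close>.\<close>

lemma mobility_eq_0:
  assumes "k > 0" "a \<le> -1 \<or> b \<ge> 1"
  shows "mobility k a b = 0"
  using assms by (auto simp: mobility_def max_def)

text \<open>The part driven by \<open>max V 0\<close> carries \<open>mobility k a b = 0\<close>.
  What survives is \<open>min V 0\<close> times a nonnegative mobility, whatever the sign of
  \<open>V\<close>.\<close>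

lemma upwind_flux_nonpos:
  assumes "k > 0" "a \<le> -1 \<or> b \<ge> 1"
  shows "upwind_flux k V a b \<le> 0"
  using mobility_eq_0[OF assms] mobility_nonneg[of k b a]
  by (simp add: upwind_flux_def mult_nonpos_nonneg)

text \<open>Mirror image: the conditions on \<open>a\<close> and \<open>b\<close> are exchanged, so
  it is the \<open>min V 0\<close> part that vanishes.\<close>

lemma upwind_flux_nonneg:
  assumes "k > 0" "b \<le> -1 \<or> a \<ge> 1"
  shows "0 \<le> upwind_flux k V a b"
  using mobility_eq_0[OF assms] mobility_nonneg[of k a b]
  by (simp add: upwind_flux_def)

text \<open>One-cell core shared by both directions; \<open>JL\<close> and \<open>JR\<close> are the
  fluxes through the two faces of the cell. The sign conditions are tied to the new value
  \<open>v\<close> because the scheme is implicit: the mobilities are evaluated at the updated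
  array.\<close>

lemma conservative_update_bounded:
  fixes u v c JL JR :: real
  assumes "\<bar>u\<bar> < 1" "c \<ge> 0" and upd: "v - u = - c * (JR - JL)"
    and low: "v \<le> -1 \<Longrightarrow> JR \<le> 0 \<and> 0 \<le> JL" and high: "v \<ge> 1 \<Longrightarrow> 0 \<le> JR \<and> JL \<le> 0"
  shows "\<bar>v\<bar> < 1"
proof -
  have "v > -1"
  proof (rule ccontr)
    assume "\<not> v > -1"
    then have "c * (JR - JL) \<le> 0"
      using low \<open>c \<ge> 0\<close> by (intro mult_nonneg_nonpos) auto
    then show False using upd \<open>\<not> v > -1\<close> \<open>\<bar>u\<bar> < 1\<close> by linarith
  qed
  moreover have "v < 1"
  proof (rule ccontr)
    assume "\<not> v < 1"
    then have "0 \<le> c * (JR - JL)"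
      using high \<open>c \<ge> 0\<close> by (intro mult_nonneg_nonneg) auto
    then show False using upd \<open>\<not> v < 1\<close> \<open>\<bar>u\<bar> < 1\<close> by linarith
  qed
  ultimately show ?thesis by linarith
qed

text \<open>An out-of-range new value fixes the signs of both face fluxes of its own cell, so no
  bound on the neighbouring new values has to be known first.\<close>

lemma substep_x_bounded:
  assumes "dx > 0" "dt > 0" "k > 0"
    and step: "substep_x Nx Ny dx dy dt \<epsilon> k F F' q \<psi> \<psi>' \<xi>"
    and bound: "\<forall>i\<in>{1..Nx}. \<forall>j\<in>{1..Ny}. \<bar>\<psi> i j\<bar> < 1"
  shows "\<forall>i\<in>{1..Nx}. \<forall>j\<in>{1..Ny}. \<bar>\<psi>' i j\<bar> < 1"
proof (intro ballI)
  fix i j assume ij: "i \<in> {1..Nx}" "j \<in> {1..Ny}"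
  let ?J = "flux_x Nx Ny dx dy \<epsilon> k F' \<psi>' \<xi>"
  have old: "\<bar>\<psi> i j\<bar> < 1"
    using bound ij by blast
  have upd: "\<psi>' i j - \<psi> i j = (if j = q then - (dt / dx) * (?J i j - ?J (i - 1) j) else 0)"
    using step ij unfolding substep_x_def by blast
  show "\<bar>\<psi>' i j\<bar> < 1"
  proof (cases "j = q")
    case True
    have "\<psi>' i j - \<psi> i j = - (dt / dx) * (?J i j - ?J (i - 1) j)"
      using upd True by simp
    then show ?thesis
    \<comment> \<open>Rotation puts the update equation first among the remaining premises, so the
      chained fact instantiates \<open>c\<close>, \<open>JR\<close> and \<open>JL\<close>.\<close>
    proof (rule conservative_update_bounded[OF old, rotated])
      show "0 \<le> dt / dx"
        using assms by simp
      \<comment> \<open>Cell \<open>i\<close> is the first argument of the flux at face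
        \<open>i\<close> and the second at face \<open>i - 1\<close>, hence the opposite signs. At
        \<open>i = 1\<close> and \<open>i = Nx\<close> the boundary face has flux 0, which satisfies
        either sign.\<close>
      show "?J i j \<le> 0 \<and> 0 \<le> ?J (i - 1) j" if "\<psi>' i j \<le> -1"
        using that \<open>k > 0\<close> by (auto simp: flux_x_def intro!: upwind_flux_nonpos upwind_flux_nonneg)
      show "0 \<le> ?J i j \<and> ?J (i - 1) j \<le> 0" if "\<psi>' i j \<ge> 1"
        using that \<open>k > 0\<close> by (auto simp: flux_x_def intro!: upwind_flux_nonpos upwind_flux_nonneg)
    qed
  next
    case False
    then show ?thesis using upd old by simp
  qed
qed

lemma substep_y_bounded:
  assumes "dy > 0" "dt > 0" "k > 0"
    and step: "substep_y Nx Ny dx dy dt \<epsilon> k F F' p \<psi> \<psi>' \<xi>"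
    and bound: "\<forall>i\<in>{1..Nx}. \<forall>j\<in>{1..Ny}. \<bar>\<psi> i j\<bar> < 1"
  shows "\<forall>i\<in>{1..Nx}. \<forall>j\<in>{1..Ny}. \<bar>\<psi>' i j\<bar> < 1"
proof (intro ballI)
  fix i j assume ij: "i \<in> {1..Nx}" "j \<in> {1..Ny}"
  let ?J = "flux_y Nx Ny dx dy \<epsilon> k F' \<psi>' \<xi>"
  have old: "\<bar>\<psi> i j\<bar> < 1"
    using bound ij by blast
  have upd: "\<psi>' i j - \<psi> i j = (if i = p then - (dt / dy) * (?J i j - ?J i (j - 1)) else 0)"
    using step ij unfolding substep_y_def by blast
  show "\<bar>\<psi>' i j\<bar> < 1"
  proof (cases "i = p")
    case True
    have "\<psi>' i j - \<psi> i j = - (dt / dy) * (?J i j - ?J i (j - 1))"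
      using upd True by simp
    then show ?thesis
    proof (rule conservative_update_bounded[OF old, rotated])
      show "0 \<le> dt / dy"
        using assms by simp
      show "?J i j \<le> 0 \<and> 0 \<le> ?J i (j - 1)" if "\<psi>' i j \<le> -1"
        using that \<open>k > 0\<close> by (auto simp: flux_y_def intro!: upwind_flux_nonpos upwind_flux_nonneg)
      show "0 \<le> ?J i j \<and> ?J i (j - 1) \<le> 0" if "\<psi>' i j \<ge> 1"
        using that \<open>k > 0\<close> by (auto simp: flux_y_def intro!: upwind_flux_nonpos upwind_flux_nonneg)
    qed
  next
    case False
    then show ?thesis using upd old by simp
  qed
qed

theorem theorem4:
  fixes Nx Ny k :: nat and dx dy dt \<epsilon> :: real
    and I :: "real set" and F F' :: "real \<Rightarrow> real"
    and \<phi> \<phi>' :: "nat \<Rightarrow> nat \<Rightarrow> real" and \<xi>' :: real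
  assumes "Nx \<ge> 2" and "Ny \<ge> 2"
    and "dx > 0" and "dy > 0" and "dt > 0" and "\<epsilon> > 0" and "k > 0"
    and "is_interval I"
    and "\<forall>x\<in>I. (F has_real_derivative F' x) (at x within I)"
    and "time_step Nx Ny dx dy dt \<epsilon> k I F F' \<phi> \<phi>' \<xi>'"
    and "\<forall>i\<in>{1..Nx}. \<forall>j\<in>{1..Ny}. \<bar>\<phi> i j\<bar> < 1"
  shows "\<forall>i\<in>{1..Nx}. \<forall>j\<in>{1..Ny}. \<bar>\<phi>' i j\<bar> < 1"
proof -
  let ?B = "\<lambda>\<psi> :: nat \<Rightarrow> nat \<Rightarrow> real. \<forall>i\<in>{1..Nx}. \<forall>j\<in>{1..Ny}. \<bar>\<psi> i j\<bar> < 1"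
  obtain \<phi>x \<xi>x \<phi>y \<xi>y where x0: "grid_eq Nx Ny (\<phi>x 0) \<phi>"
    and xs: "\<forall>q\<in>{1..Ny}. substep_x Nx Ny dx dy dt \<epsilon> k F F' q (\<phi>x (q - 1)) (\<phi>x q) (\<xi>x q)"
    and y0: "grid_eq Nx Ny (\<phi>y 0) (\<phi>x Ny)"
    and ys: "\<forall>p\<in>{1..Nx}. substep_y Nx Ny dx dy dt \<epsilon> k F F' p (\<phi>y (p - 1)) (\<phi>y p) (\<xi>y p)"
    and final: "grid_eq Nx Ny \<phi>' (\<phi>y Nx)"
    using assms(10) unfolding time_step_def by blast
  \<comment> \<open>The bound is carried through the successive row updates; \<open>grid_eq\<close>
    supplies the start, since \<open>\<phi>x 0\<close> and \<open>\<phi>\<close> are only known to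
    agree on the grid.\<close>
  have x: "?B (\<phi>x q)" if "q \<le> Ny" for q
    using that
  proof (induction q)
    case 0
    then show ?case using x0 assms(11) by (simp add: grid_eq_def)
  next
    case (Suc q)
    have "substep_x Nx Ny dx dy dt \<epsilon> k F F' (Suc q) (\<phi>x q) (\<phi>x (Suc q)) (\<xi>x (Suc q))"
      using bspec[OF xs, of "Suc q"] Suc.prems by simp
    then show ?case
      using Suc substep_x_bounded[OF \<open>dx > 0\<close> \<open>dt > 0\<close> \<open>k > 0\<close>] by simp
  qed
  \<comment> \<open>The second sweep starts from the result of the first, so its base case is the
    bound just obtained at \<open>q = Ny\<close>.\<close>
  have y: "?B (\<phi>y p)" if "p \<le> Nx" for p
    using that
  proof (induction p)
    case 0
    then show ?case using y0 x[of Ny] by (simp add: grid_eq_def)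
  next
    case (Suc p)
    have "substep_y Nx Ny dx dy dt \<epsilon> k F F' (Suc p) (\<phi>y p) (\<phi>y (Suc p)) (\<xi>y (Suc p))"
      using bspec[OF ys, of "Suc p"] Suc.prems by simp
    then show ?case
      using Suc substep_y_bounded[OF \<open>dy > 0\<close> \<open>dt > 0\<close> \<open>k > 0\<close>] by simp
  qed
  show ?thesis
    using final y[of Nx] by (simp add: grid_eq_def)
qed

end
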